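(* Let $\mathcal L$ be a reverse tangent category (with pullbacks). For an object $A$ let $p_A:TA\to A$ be its tangent bundle and $p_A^*:T^*A\to A$ the dual bundle of $p_A$; for $f:A\to B$ let $(f,T^*f)$, with $T^*f:f^*T^*B\to T^*A$, be the image under the involution of $\mathcal L$ of the linear bundle morphism $(f,Tf):p_A\to p_B$. Then there is a functor $\mathcal T^*:\mathcal L\to\mathrm{Lens}(\mathcal L)$ sending $A$ to $p_A^*:T^*A\to A$ and $f:A\to B$ to $$\big(\,f\,,\ T^*A\xleftarrow{T^*f}f^*T^*B\xrightarrow{\overline f}T^*B\,\big),$$ where $\overline f:f^*T^*B\to T^*B$ is the projection of the pullback of $p_B^*:T^*B\to B$ along $f$.
   Context: **Lenses.** Let $\mathcal L$ be a category with pullbacks. For $A\xrightarrow{f}B\xleftarrow{q}\beta$ write $A\xleftarrow{f^*q}f^*\beta\xrightarrow{\overline f}\beta$ for the pullback. The category $\mathrm{Lens}(\mathcal L)$ has as objects the arrows $p:\alpha\to A$ of $\mathcal L$; an arrow from $p:\alpha\to A$ to $q:\beta\to B$ is an arrow $f:A\to B$ together with a span $\alpha\xleftarrow{F}f^*\beta\xrightarrow{\overline f}\beta$ in which $\overline f$ is the projection of the pullback of $q$ along $f$ and $F;p=f^*q$ (diagrammatic composition). The identity on $p:\alpha\to A$ is $1_A$ with the identity span on $\alpha$; composition is composition in $\mathcal L$ of the first components and composition of spans (by pullback; spans up to isomorphism, as usual). **Reverse tangent categories** (Cruttwell–Lemay). A tangent category (Cockett–Cruttwell) is a category $\mathcal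 L$ with an endofunctor $T$ and natural transformations $p:T\to1$ (projection), $0:1\to T$, $+:T_2\to T$ making each $p_A:TA\to A$ an additive bundle, vertical lift $\ell:T\to T^2$ and canonical flip $c:T^2\to T^2$, satisfying the usual axioms. A differential bundle is an additive bundle $q:E\to A$ equipped with a lift $E\to TE$ satisfying the usual universality axiom; a linear bundle morphism from $q:E\to A$ to $q':E'\to B$ is a pair $(f:A\to B,\,g:E\to E')$ commuting with the projections and with the lifts. A display system $\mathsf D$ of differential bundles is a class of differential bundles closed under pullback along all maps (these pullbacks being preserved by all $T^n$) and, here, containing all tangent bundles; $\mathrm{DBun}_{\mathsf D}(\mathcal L)$ is the category of bundles in $\mathsf D$ and linear bundle morphisms, fibred over $\mathcal L$ by taking the base. Its dual fibration $\mathrm{DBun}^\circ_{\mathsf D}(\mathcal L)\to\mathcal L$ has the same objects; a morphism in it from $q:E\to A$ to $q':E'\to B$ is an $f:A\to B$ together with a linear bundle morphism $g:f^*E'\to E$ over $1_A$ (so in particular $g;q=f^*q'$); composition of $(f,g)$ with $(f',g')$ is $(f;f',\,f^*(g');g)$. A reverse tangent category is a tangent category with such a $\mathsf D$ and an involution of fibrations $(\_)^*:\mathrm{DBun}_{\mathsf D}(\mathcal L)\to\mathrm{DBun}^\circ_{\mathsf D}(\mathcal L)$ over $\mathcal L$ (identity on bases), sending a bundle $q:E\to A$ to its dual bundle $q^*:E^*\to A$, with $E^{**}\simeq E$ naturally and coherently. For $f:A\to B$, the pair $(f,Tf)$ is a linear bundle morphism from $p_A$ to $p_B$. *)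

theory Defs
  imports Main
begin

section \<open>Categories, functors, pullbacks\<close>

text \<open>Composition is written in diagrammatic order throughout.\<close>

record ('o, 'm) cat =
  Ob :: "'o set"
  Ar :: "'m set"
  Dom :: "'m \<Rightarrow> 'o"
  Cod :: "'m \<Rightarrow> 'o"
  Id :: "'o \<Rightarrow> 'm"
  Comp :: "'m \<Rightarrow> 'm \<Rightarrow> 'm"  (infixl ";;\<index>" 55)

definition hom :: "('o, 'm, 'z) cat_scheme \<Rightarrow> 'o \<Rightarrow> 'o \<Rightarrow> 'm set" where
  "hom C a b = {f \<in> Ar C. Dom C f = a \<and> Cod C f = b}"

locale category =
  fixes C :: "('o, 'm, 'z) cat_scheme" (structure)
  assumes Dom_Ob: "f \<in> Ar C \<Longrightarrow> Dom C f \<in> Ob C"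
    and Cod_Ob: "f \<in> Ar C \<Longrightarrow> Cod C f \<in> Ob C"
    and Id_hom: "a \<in> Ob C \<Longrightarrow> Id C a \<in> hom C a a"
    and Comp_hom: "\<lbrakk>f \<in> Ar C; g \<in> Ar C; Cod C f = Dom C g\<rbrakk>
      \<Longrightarrow> f ;; g \<in> hom C (Dom C f) (Cod C g)"
    and Id_left: "f \<in> Ar C \<Longrightarrow> Id C (Dom C f) ;; f = f"
    and Id_right: "f \<in> Ar C \<Longrightarrow> f ;; Id C (Cod C f) = f"
    and Comp_assoc: "\<lbrakk>f \<in> Ar C; g \<in> Ar C; h \<in> Ar C; Cod C f = Dom C g; Cod C g = Dom C h\<rbrakk>
      \<Longrightarrow> (f ;; g) ;; h = f ;; (g ;; h)"

text \<open>Functoriality only: this does not assert that \<open>C\<close> and \<open>D\<close> are categories.\<close>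

definition is_functor ::
  "('o, 'm, 'z) cat_scheme \<Rightarrow> ('p, 'n, 'y) cat_scheme \<Rightarrow> ('o \<Rightarrow> 'p) \<Rightarrow> ('m \<Rightarrow> 'n) \<Rightarrow> bool" where
  "is_functor C D Fo Fa \<longleftrightarrow>
    (\<forall>a \<in> Ob C. Fo a \<in> Ob D) \<and>
    (\<forall>f \<in> Ar C. Fa f \<in> hom D (Fo (Dom C f)) (Fo (Cod C f))) \<and>
    (\<forall>a \<in> Ob C. Fa (Id C a) = Id D (Fo a)) \<and>
    (\<forall>f \<in> Ar C. \<forall>g \<in> Ar C. Cod C f = Dom C g \<longrightarrow> Fa (f ;;\<^bsub>C\<^esub> g) = Fa f ;;\<^bsub>D\<^esub> Fa g)"

definition nat_trans ::
  "('o, 'm, 'z) cat_scheme \<Rightarrow> ('p, 'n, 'y) cat_scheme \<Rightarrow> ('o \<Rightarrow> 'p) \<Rightarrow> ('m \<Rightarrow> 'n) \<Rightarrow>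
    ('o \<Rightarrow> 'p) \<Rightarrow> ('m \<Rightarrow> 'n) \<Rightarrow> ('o \<Rightarrow> 'n) \<Rightarrow> bool" where
  "nat_trans C D Fo Fa Go Ga t \<longleftrightarrow>
    (\<forall>a \<in> Ob C. t a \<in> hom D (Fo a) (Go a)) \<and>
    (\<forall>f \<in> Ar C. Fa f ;;\<^bsub>D\<^esub> t (Cod C f) = t (Dom C f) ;;\<^bsub>D\<^esub> Ga f)"

definition inverse_arrows :: "('o, 'm, 'z) cat_scheme \<Rightarrow> 'm \<Rightarrow> 'm \<Rightarrow> bool" where
  "inverse_arrows C f g \<longleftrightarrow> f \<in> Ar C \<and> g \<in> hom C (Cod C f) (Dom C f) \<and>
    f ;;\<^bsub>C\<^esub> g = Id C (Dom C f) \<and> g ;;\<^bsub>C\<^esub> f = Id C (Cod C f)"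

definition iso :: "('o, 'm, 'z) cat_scheme \<Rightarrow> 'm \<Rightarrow> bool" where
  "iso C f \<longleftrightarrow> (\<exists>g. inverse_arrows C f g)"

definition inv_arrow :: "('o, 'm, 'z) cat_scheme \<Rightarrow> 'm \<Rightarrow> 'm" where
  "inv_arrow C f = (THE g. inverse_arrows C f g)"

text \<open>\<open>is_pullback C f q a b\<close>: the square \<open>a ;; f = b ;; q\<close> exhibits \<open>a\<close> as the pullback
  of \<open>q\<close> along \<open>f\<close>.\<close>

definition is_pullback :: "('o, 'm, 'z) cat_scheme \<Rightarrow> 'm \<Rightarrow> 'm \<Rightarrow> 'm \<Rightarrow> 'm \<Rightarrow> bool" where
  "is_pullback C f q a b \<longleftrightarrow>
    f \<in> Ar C \<and> q \<in> Ar C \<and> a \<in> Ar C \<and> b \<in> Ar C \<and>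
    Cod C f = Cod C q \<and> Cod C a = Dom C f \<and> Cod C b = Dom C q \<and> Dom C a = Dom C b \<and>
    a ;;\<^bsub>C\<^esub> f = b ;;\<^bsub>C\<^esub> q \<and>
    (\<forall>x \<in> Ar C. \<forall>y \<in> Ar C.
      Dom C x = Dom C y \<and> Cod C x = Dom C f \<and> Cod C y = Dom C q \<and> x ;;\<^bsub>C\<^esub> f = y ;;\<^bsub>C\<^esub> q \<longrightarrow>
      (\<exists>!u. u \<in> hom C (Dom C x) (Dom C a) \<and> u ;;\<^bsub>C\<^esub> a = x \<and> u ;;\<^bsub>C\<^esub> b = y))"

text \<open>The mediating arrow into a pullback with projections \<open>a\<close>, \<open>b\<close>.\<close>

definition pair :: "('o, 'm, 'z) cat_scheme \<Rightarrow> 'm \<Rightarrow> 'm \<Rightarrow> 'm \<Rightarrow> 'm \<Rightarrow> 'm" where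
  "pair C a b x y =
    (THE u. u \<in> hom C (Dom C x) (Dom C a) \<and> u ;;\<^bsub>C\<^esub> a = x \<and> u ;;\<^bsub>C\<^esub> b = y)"

text \<open>The wide pullback of \<open>n\<close> copies of \<open>q\<close>, with projections \<open>\<pi> i\<close> (\<open>i < n\<close>) and
  composite \<open>b\<close> to the base; keeping \<open>b\<close> covers the case \<open>n = 0\<close>.\<close>

definition is_pullback_power ::
  "('o, 'm, 'z) cat_scheme \<Rightarrow> 'm \<Rightarrow> nat \<Rightarrow> 'm \<Rightarrow> (nat \<Rightarrow> 'm) \<Rightarrow> bool" where
  "is_pullback_power C q n b \<pi> \<longleftrightarrow>
    q \<in> Ar C \<and> b \<in> Ar C \<and> Cod C b = Cod C q \<and>
    (\<forall>i<n. \<pi> i \<in> hom C (Dom C b) (Dom C q) \<and> \<pi> i ;;\<^bsub>C\<^esub> q = b) \<and>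
    (\<forall>h \<in> Ar C. \<forall>x. Cod C h = Cod C q \<and>
      (\<forall>i<n. x i \<in> hom C (Dom C h) (Dom C q) \<and> x i ;;\<^bsub>C\<^esub> q = h) \<longrightarrow>
      (\<exists>!u. u \<in> hom C (Dom C h) (Dom C b) \<and> u ;;\<^bsub>C\<^esub> b = h \<and> (\<forall>i<n. u ;;\<^bsub>C\<^esub> \<pi> i = x i)))"

text \<open>Categories with a chosen pullback of every cospan: \<open>pb1 C f q\<close> is \<open>f\<^sup>*q\<close>, the pullback
  of \<open>q\<close> along \<open>f\<close>, and \<open>pb2 C f q\<close> is the other projection.\<close>

record ('o, 'm) pbcat = "('o, 'm) cat" +
  pb1 :: "'m \<Rightarrow> 'm \<Rightarrow> 'm"
  pb2 :: "'m \<Rightarrow> 'm \<Rightarrow> 'm"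

locale category_with_pullbacks = category C for C :: "('o, 'm, 'z) pbcat_scheme" (structure) +
  assumes pullbacks: "\<lbrakk>f \<in> Ar C; q \<in> Ar C; Cod C f = Cod C q\<rbrakk>
    \<Longrightarrow> is_pullback C f q (pb1 C f q) (pb2 C f q)"


section \<open>The category of lenses\<close>

definition span_class :: "('o, 'm, 'z) cat_scheme \<Rightarrow> 'm \<Rightarrow> 'm \<Rightarrow> ('m \<times> 'm) set" where
  "span_class C F u = {(i ;;\<^bsub>C\<^esub> F, i ;;\<^bsub>C\<^esub> u) | i. iso C i \<and> Cod C i = Dom C F}"

text \<open>Composition of isomorphism classes of spans: all composites of representatives, formed
  with any pullback. These make up one isomorphism class.\<close>

definition span_comp ::
  "('o, 'm, 'z) cat_scheme \<Rightarrow> ('m \<times> 'm) set \<Rightarrow> ('m \<times> 'm) set \<Rightarrow> ('m \<times> 'm) set" where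
  "span_comp C X Y = {(k ;;\<^bsub>C\<^esub> F, k' ;;\<^bsub>C\<^esub> u') | k k' F u F' u'.
    (F, u) \<in> X \<and> (F', u') \<in> Y \<and> is_pullback C u F' k k'}"

record 'm lens =
  lsrc :: 'm
  ltgt :: 'm
  lbase :: 'm
  lspan :: "('m \<times> 'm) set"

definition lens_arrows :: "('o, 'm, 'z) cat_scheme \<Rightarrow> 'm lens set" where
  "lens_arrows C = {m. lsrc m \<in> Ar C \<and> ltgt m \<in> Ar C \<and>
    lbase m \<in> hom C (Cod C (lsrc m)) (Cod C (ltgt m)) \<and>
    (\<exists>a u F. is_pullback C (lbase m) (ltgt m) a u \<and>
      F \<in> hom C (Dom C a) (Dom C (lsrc m)) \<and> F ;;\<^bsub>C\<^esub> lsrc m = a \<and>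
      lspan m = span_class C F u)}"

definition Lens :: "('o, 'm, 'z) cat_scheme \<Rightarrow> ('m, 'm lens) cat" where
  "Lens C = \<lparr>
    Ob = Ar C,
    Ar = lens_arrows C,
    Dom = lsrc,
    Cod = ltgt,
    Id = (\<lambda>p. \<lparr>lsrc = p, ltgt = p, lbase = Id C (Cod C p),
      lspan = span_class C (Id C (Dom C p)) (Id C (Dom C p))\<rparr>),
    Comp = (\<lambda>m n. \<lparr>lsrc = lsrc m, ltgt = ltgt n, lbase = lbase m ;;\<^bsub>C\<^esub> lbase n,
      lspan = span_comp C (lspan m) (lspan n)\<rparr>)\<rparr>"


section \<open>Additive bundles\<close>

text \<open>\<open>alft\<close>, \<open>argt\<close> are the projections of a pullback of \<open>aprj\<close> along itself. The pullback is
  part of the data, so that the image of an additive bundle under a functor preserving this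
  pullback is again one, without inserting comparison isomorphisms.\<close>

record 'm abun =
  aprj :: 'm
  alft :: 'm
  argt :: 'm
  aadd :: 'm
  azero :: 'm

definition asum :: "('o, 'm, 'z) cat_scheme \<Rightarrow> 'm abun \<Rightarrow> 'm \<Rightarrow> 'm \<Rightarrow> 'm" where
  "asum C a x y = pair C (alft a) (argt a) x y ;;\<^bsub>C\<^esub> aadd a"

text \<open>A commutative monoid in the slice over the base; the monoid laws are stated for
  generalized elements \<open>x\<close>, \<open>y\<close>, \<open>z\<close> of the total object over a common map to the base.\<close>

definition additive_bundle :: "('o, 'm, 'z) cat_scheme \<Rightarrow> 'm abun \<Rightarrow> bool" where
  "additive_bundle C a \<longleftrightarrow>
    is_pullback C (aprj a) (aprj a) (alft a) (argt a) \<and>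
    aadd a \<in> hom C (Dom C (alft a)) (Dom C (aprj a)) \<and>
    azero a \<in> hom C (Cod C (aprj a)) (Dom C (aprj a)) \<and>
    aadd a ;;\<^bsub>C\<^esub> aprj a = alft a ;;\<^bsub>C\<^esub> aprj a \<and>
    azero a ;;\<^bsub>C\<^esub> aprj a = Id C (Cod C (aprj a)) \<and>
    (\<forall>w. \<forall>x \<in> hom C w (Dom C (aprj a)). \<forall>y \<in> hom C w (Dom C (aprj a)).
      \<forall>z \<in> hom C w (Dom C (aprj a)).
      x ;;\<^bsub>C\<^esub> aprj a = y ;;\<^bsub>C\<^esub> aprj a \<and> y ;;\<^bsub>C\<^esub> aprj a = z ;;\<^bsub>C\<^esub> aprj a \<longrightarrow>
      asum C a (asum C a x y) z = asum C a x (asum C a y z) \<and>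
      asum C a x y = asum C a y x \<and>
      asum C a (x ;;\<^bsub>C\<^esub> aprj a ;;\<^bsub>C\<^esub> azero a) x = x)"

definition additive_morphism ::
  "('o, 'm, 'z) cat_scheme \<Rightarrow> 'm abun \<Rightarrow> 'm abun \<Rightarrow> 'm \<Rightarrow> 'm \<Rightarrow> bool" where
  "additive_morphism C a a' f g \<longleftrightarrow>
    f \<in> hom C (Cod C (aprj a)) (Cod C (aprj a')) \<and>
    g \<in> hom C (Dom C (aprj a)) (Dom C (aprj a')) \<and>
    g ;;\<^bsub>C\<^esub> aprj a' = aprj a ;;\<^bsub>C\<^esub> f \<and>
    azero a ;;\<^bsub>C\<^esub> g = f ;;\<^bsub>C\<^esub> azero a' \<and>
    aadd a ;;\<^bsub>C\<^esub> g = asum C a' (alft a ;;\<^bsub>C\<^esub> g) (argt a ;;\<^bsub>C\<^esub> g)"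


section \<open>Tangent categories\<close>

text \<open>\<open>tadd A\<close> has as its domain the chosen pullback of \<open>tp A\<close> along itself.\<close>

record ('o, 'm) tcat = "('o, 'm) pbcat" +
  TOb :: "'o \<Rightarrow> 'o"
  TAr :: "'m \<Rightarrow> 'm"
  tp :: "'o \<Rightarrow> 'm"
  tzero :: "'o \<Rightarrow> 'm"
  tadd :: "'o \<Rightarrow> 'm"
  tlift :: "'o \<Rightarrow> 'm"
  tflip :: "'o \<Rightarrow> 'm"

definition T_image :: "('o, 'm, 'z) tcat_scheme \<Rightarrow> 'm abun \<Rightarrow> 'm abun" where
  "T_image L a = \<lparr>aprj = TAr L (aprj a), alft = TAr L (alft a), argt = TAr L (argt a),
    aadd = TAr L (aadd a), azero = TAr L (azero a)\<rparr>"

text \<open>Pullbacks preserved by all powers of the tangent functor; the case \<open>n = 0\<close> says that the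
  square itself is a pullback.\<close>

definition T_pullback :: "('o, 'm, 'z) tcat_scheme \<Rightarrow> 'm \<Rightarrow> 'm \<Rightarrow> 'm \<Rightarrow> 'm \<Rightarrow> bool" where
  "T_pullback L f q a b \<longleftrightarrow> (\<forall>n. is_pullback L ((TAr L ^^ n) f) ((TAr L ^^ n) q)
    ((TAr L ^^ n) a) ((TAr L ^^ n) b))"

definition T_preserves_powers :: "('o, 'm, 'z) tcat_scheme \<Rightarrow> 'm \<Rightarrow> bool" where
  "T_preserves_powers L q \<longleftrightarrow> (\<forall>k b \<pi>. is_pullback_power L q k b \<pi> \<longrightarrow>
    (\<forall>n. is_pullback_power L ((TAr L ^^ n) q) k ((TAr L ^^ n) b) (\<lambda>i. (TAr L ^^ n) (\<pi> i))))"

definition tangent_abun :: "('o, 'm, 'z) tcat_scheme \<Rightarrow> 'o \<Rightarrow> 'm abun" where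
  "tangent_abun L A = \<lparr>aprj = tp L A, alft = pb1 L (tp L A) (tp L A),
    argt = pb2 L (tp L A) (tp L A), aadd = tadd L A, azero = tzero L A\<rparr>"

text \<open>For an additive bundle \<open>a\<close> with total object \<open>E\<close> and \<open>l : E \<rightarrow> TE\<close>, this is
  \<open>\<langle>\<pi>\<^sub>0 l, \<pi>\<^sub>1 0\<^sub>E\<rangle> T(+) : E\<^sub>2 \<rightarrow> TE\<close>.\<close>

definition lift_map :: "('o, 'm, 'z) tcat_scheme \<Rightarrow> 'm abun \<Rightarrow> 'm \<Rightarrow> 'm" where
  "lift_map L a l =
    asum L (T_image L a) (alft a ;;\<^bsub>L\<^esub> l) (argt a ;;\<^bsub>L\<^esub> tzero L (Dom L (aprj a)))"

locale tangent_category = category_with_pullbacks L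
  for L :: "('o, 'm, 'z) tcat_scheme" (structure) +
  assumes T_functor: "is_functor L L (TOb L) (TAr L)"
    and tp_natural: "nat_trans L L (TOb L) (TAr L) (\<lambda>A. A) (\<lambda>f. f) (tp L)"
    and tp_powers: "A \<in> Ob L \<Longrightarrow> T_preserves_powers L (tp L A)"
    and tzero_natural: "nat_trans L L (\<lambda>A. A) (\<lambda>f. f) (TOb L) (TAr L) (tzero L)"
    and tadd_natural: "f \<in> Ar L \<Longrightarrow>
      tadd L (Dom L f) ;; TAr L f =
      asum L (tangent_abun L (Cod L f))
        (pb1 L (tp L (Dom L f)) (tp L (Dom L f)) ;; TAr L f)
        (pb2 L (tp L (Dom L f)) (tp L (Dom L f)) ;; TAr L f)"
    and tangent_additive: "A \<in> Ob L \<Longrightarrow> additive_bundle L (tangent_abun L A)"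
    and tlift_natural:
      "nat_trans L L (TOb L) (TAr L) (\<lambda>A. TOb L (TOb L A)) (\<lambda>f. TAr L (TAr L f)) (tlift L)"
    and tlift_additive: "A \<in> Ob L \<Longrightarrow>
      additive_morphism L (tangent_abun L A) (T_image L (tangent_abun L A)) (tzero L A) (tlift L A)"
    and tflip_natural:
      "nat_trans L L (\<lambda>A. TOb L (TOb L A)) (\<lambda>f. TAr L (TAr L f))
        (\<lambda>A. TOb L (TOb L A)) (\<lambda>f. TAr L (TAr L f)) (tflip L)"
    and tflip_additive: "A \<in> Ob L \<Longrightarrow>
      additive_morphism L (T_image L (tangent_abun L A)) (tangent_abun L (TOb L A))
        (Id L (TOb L A)) (tflip L A)"
    and tflip_flip: "A \<in> Ob L \<Longrightarrow> tflip L A ;; tflip L A = Id L (TOb L (TOb L A))"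
    and tlift_flip: "A \<in> Ob L \<Longrightarrow> tlift L A ;; tflip L A = tlift L A"
    and tlift_lift: "A \<in> Ob L \<Longrightarrow>
      tlift L A ;; TAr L (tlift L A) = tlift L A ;; tlift L (TOb L A)"
    and tflip_braid: "A \<in> Ob L \<Longrightarrow>
      TAr L (tflip L A) ;; tflip L (TOb L A) ;; TAr L (tflip L A) =
      tflip L (TOb L A) ;; TAr L (tflip L A) ;; tflip L (TOb L A)"
    and tlift_flip_flip: "A \<in> Ob L \<Longrightarrow>
      tlift L (TOb L A) ;; TAr L (tflip L A) ;; tflip L (TOb L A) =
      tflip L A ;; TAr L (tlift L A)"
    and tlift_universal: "A \<in> Ob L \<Longrightarrow>
      T_pullback L (tzero L A) (TAr L (tp L A)) (pb1 L (tp L A) (tp L A) ;; tp L A)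
        (lift_map L (tangent_abun L A) (tlift L A))"


section \<open>Differential bundles\<close>

text \<open>The domain of \<open>badd\<close> is the chosen pullback of \<open>bprj\<close> along itself.\<close>

record 'm dbun =
  bprj :: 'm
  badd :: 'm
  bzero :: 'm
  blift :: 'm

definition abun_of :: "('o, 'm, 'z) pbcat_scheme \<Rightarrow> 'm dbun \<Rightarrow> 'm abun" where
  "abun_of L b = \<lparr>aprj = bprj b, alft = pb1 L (bprj b) (bprj b), argt = pb2 L (bprj b) (bprj b),
    aadd = badd b, azero = bzero b\<rparr>"

abbreviation total :: "('o, 'm, 'z) pbcat_scheme \<Rightarrow> 'm dbun \<Rightarrow> 'o" where
  "total L b \<equiv> Dom L (bprj b)"

abbreviation base :: "('o, 'm, 'z) pbcat_scheme \<Rightarrow> 'm dbun \<Rightarrow> 'o" where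
  "base L b \<equiv> Cod L (bprj b)"

definition differential_bundle :: "('o, 'm, 'z) tcat_scheme \<Rightarrow> 'm dbun \<Rightarrow> bool" where
  "differential_bundle L b \<longleftrightarrow>
    bprj b \<in> Ar L \<and>
    additive_bundle L (abun_of L b) \<and>
    T_preserves_powers L (bprj b) \<and>
    blift b \<in> hom L (total L b) (TOb L (total L b)) \<and>
    additive_morphism L (abun_of L b) (T_image L (abun_of L b)) (tzero L (base L b)) (blift b) \<and>
    additive_morphism L (abun_of L b) (tangent_abun L (total L b)) (bzero b) (blift b) \<and>
    blift b ;;\<^bsub>L\<^esub> tlift L (total L b) = blift b ;;\<^bsub>L\<^esub> TAr L (blift b) \<and>
    T_pullback L (tzero L (base L b)) (TAr L (bprj b)) (pb1 L (bprj b) (bprj b) ;;\<^bsub>L\<^esub> bprj b)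
      (lift_map L (abun_of L b) (blift b))"

definition tangent_bundle :: "('o, 'm, 'z) tcat_scheme \<Rightarrow> 'o \<Rightarrow> 'm dbun" where
  "tangent_bundle L A =
    \<lparr>bprj = tp L A, badd = tadd L A, bzero = tzero L A, blift = tlift L A\<rparr>"

definition linear_morphism ::
  "('o, 'm, 'z) tcat_scheme \<Rightarrow> 'm dbun \<Rightarrow> 'm dbun \<Rightarrow> 'm \<Rightarrow> 'm \<Rightarrow> bool" where
  "linear_morphism L b b' f g \<longleftrightarrow>
    f \<in> hom L (base L b) (base L b') \<and> g \<in> hom L (total L b) (total L b') \<and>
    g ;;\<^bsub>L\<^esub> bprj b' = bprj b ;;\<^bsub>L\<^esub> f \<and> g ;;\<^bsub>L\<^esub> blift b' = blift b ;;\<^bsub>L\<^esub> TAr L g"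

text \<open>The structure induced on the projection \<open>a\<close> of a pullback square \<open>a ;; f = g ;; bprj b\<close>.\<close>

definition induced_bundle ::
  "('o, 'm, 'z) tcat_scheme \<Rightarrow> 'm \<Rightarrow> 'm dbun \<Rightarrow> 'm \<Rightarrow> 'm \<Rightarrow> 'm dbun" where
  "induced_bundle L f b a g = \<lparr>
    bprj = a,
    badd = pair L a g (pb1 L a a ;;\<^bsub>L\<^esub> a)
      (asum L (abun_of L b) (pb1 L a a ;;\<^bsub>L\<^esub> g) (pb2 L a a ;;\<^bsub>L\<^esub> g)),
    bzero = pair L a g (Id L (Dom L f)) (f ;;\<^bsub>L\<^esub> bzero b),
    blift = pair L (TAr L a) (TAr L g) (a ;;\<^bsub>L\<^esub> tzero L (Dom L f)) (g ;;\<^bsub>L\<^esub> blift b)\<rparr>"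

text \<open>The chosen pullback \<open>f\<^sup>*E\<close> of a bundle.\<close>

definition reindex :: "('o, 'm, 'z) tcat_scheme \<Rightarrow> 'm \<Rightarrow> 'm dbun \<Rightarrow> 'm dbun" where
  "reindex L f b = induced_bundle L f b (pb1 L f (bprj b)) (pb2 L f (bprj b))"


section \<open>Reverse tangent categories\<close>

record 'm bmor =
  bsrc :: "'m dbun"
  btgt :: "'m dbun"
  bbase :: 'm
  btop :: 'm

text \<open>\<open>bdual_ob\<close> and \<open>bdual_ar\<close> are the two parts of the involution, and \<open>bdual_iso b\<close> is the
  isomorphism from \<open>b\<close> to its double dual.\<close>

record ('o, 'm) rtcat = "('o, 'm) tcat" +
  display :: "'m dbun set"
  bdual_ob :: "'m dbun \<Rightarrow> 'm dbun"
  bdual_ar :: "'m bmor \<Rightarrow> 'm bmor"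
  bdual_iso :: "'m dbun \<Rightarrow> 'm bmor"

definition DBun :: "('o, 'm, 'z) rtcat_scheme \<Rightarrow> ('m dbun, 'm bmor) cat" where
  "DBun L = \<lparr>
    Ob = display L,
    Ar = {e. bsrc e \<in> display L \<and> btgt e \<in> display L \<and>
      linear_morphism L (bsrc e) (btgt e) (bbase e) (btop e)},
    Dom = bsrc,
    Cod = btgt,
    Id = (\<lambda>b. \<lparr>bsrc = b, btgt = b, bbase = Id L (base L b), btop = Id L (total L b)\<rparr>),
    Comp = (\<lambda>e e'. \<lparr>bsrc = bsrc e, btgt = btgt e', bbase = bbase e ;;\<^bsub>L\<^esub> bbase e',
      btop = btop e ;;\<^bsub>L\<^esub> btop e'\<rparr>)\<rparr>"

text \<open>The canonical isomorphism from \<open>(f ;; f')\<^sup>*q\<close> to \<open>f\<^sup>*(f'\<^sup>*q)\<close> on total objects.\<close>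

definition reindex_comp :: "('o, 'm, 'z) pbcat_scheme \<Rightarrow> 'm \<Rightarrow> 'm \<Rightarrow> 'm \<Rightarrow> 'm" where
  "reindex_comp L f f' q =
    pair L (pb1 L f (pb1 L f' q)) (pb2 L f (pb1 L f' q))
      (pb1 L (f ;;\<^bsub>L\<^esub> f') q)
      (pair L (pb1 L f' q) (pb2 L f' q) (pb1 L (f ;;\<^bsub>L\<^esub> f') q ;;\<^bsub>L\<^esub> f) (pb2 L (f ;;\<^bsub>L\<^esub> f') q))"

text \<open>\<open>f\<^sup>*(g)\<close>, for an arrow \<open>g\<close> from \<open>q\<close> to \<open>q'\<close> over the codomain of \<open>f\<close>.\<close>

definition reindex_ar :: "('o, 'm, 'z) pbcat_scheme \<Rightarrow> 'm \<Rightarrow> 'm \<Rightarrow> 'm \<Rightarrow> 'm \<Rightarrow> 'm" where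
  "reindex_ar L f q q' g = pair L (pb1 L f q') (pb2 L f q') (pb1 L f q) (pb2 L f q ;;\<^bsub>L\<^esub> g)"

text \<open>The dual fibration. An arrow \<open>e\<close> has \<open>btop e\<close> going from \<open>(bbase e)\<^sup>*(btgt e)\<close> to
  \<open>bsrc e\<close>. The identity on \<open>b\<close> has as its top arrow the canonical isomorphism from \<open>1\<^sup>*b\<close>
  to \<open>b\<close>, and composition uses \<open>reindex_comp\<close>, because chosen pullbacks need not be
  strictly functorial.\<close>

definition DBun_dual :: "('o, 'm, 'z) rtcat_scheme \<Rightarrow> ('m dbun, 'm bmor) cat" where
  "DBun_dual L = \<lparr>
    Ob = display L,
    Ar = {e. bsrc e \<in> display L \<and> btgt e \<in> display L \<and>
      bbase e \<in> hom L (base L (bsrc e)) (base L (btgt e)) \<and>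
      linear_morphism L (reindex L (bbase e) (btgt e)) (bsrc e)
        (Id L (base L (bsrc e))) (btop e)},
    Dom = bsrc,
    Cod = btgt,
    Id = (\<lambda>b. \<lparr>bsrc = b, btgt = b, bbase = Id L (base L b),
      btop = pb2 L (Id L (base L b)) (bprj b)\<rparr>),
    Comp = (\<lambda>e e'. \<lparr>bsrc = bsrc e, btgt = btgt e', bbase = bbase e ;;\<^bsub>L\<^esub> bbase e',
      btop = reindex_comp L (bbase e) (bbase e') (bprj (btgt e')) ;;\<^bsub>L\<^esub>
        reindex_ar L (bbase e) (pb1 L (bbase e') (bprj (btgt e'))) (bprj (btgt e)) (btop e') ;;\<^bsub>L\<^esub>
        btop e\<rparr>)\<rparr>"

definition cartesian ::
  "('p, 'n, 'y) cat_scheme \<Rightarrow> ('o, 'm, 'z) cat_scheme \<Rightarrow> ('p \<Rightarrow> 'o) \<Rightarrow> ('n \<Rightarrow> 'm) \<Rightarrow> 'n \<Rightarrow> bool" where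
  "cartesian E B Po Pa e \<longleftrightarrow> e \<in> Ar E \<and>
    (\<forall>h \<in> Ar E. \<forall>w \<in> hom B (Po (Dom E h)) (Po (Dom E e)).
      Cod E h = Cod E e \<and> w ;;\<^bsub>B\<^esub> Pa e = Pa h \<longrightarrow>
      (\<exists>!v. v \<in> hom E (Dom E h) (Dom E e) \<and> Pa v = w \<and> v ;;\<^bsub>E\<^esub> e = h))"

text \<open>The dual of an arrow over an identity, as an arrow of \<open>DBun L\<close> from the dual of the
  target to the dual of the source.\<close>

definition vertical_dual :: "('o, 'm, 'z) rtcat_scheme \<Rightarrow> 'm bmor \<Rightarrow> 'm bmor" where
  "vertical_dual L e = \<lparr>
    bsrc = bdual_ob L (btgt e),
    btgt = bdual_ob L (bsrc e),
    bbase = bbase e,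
    btop = inv_arrow L (pb2 L (bbase e) (bprj (bdual_ob L (btgt e)))) ;;\<^bsub>L\<^esub> btop (bdual_ar L e)\<rparr>"

text \<open>The involution induced on the dual fibration, as a functor from \<open>DBun_dual L\<close> to
  \<open>DBun L\<close> (identified with its own double dual). An arrow \<open>(f, g)\<close> from \<open>E\<close> to \<open>E'\<close> goes to
  \<open>E\<^sup>* \<rightarrow> (f\<^sup>*E')\<^sup>* \<simeq> f\<^sup>*(E'\<^sup>*) \<rightarrow> E'\<^sup>*\<close>, the isomorphism being the inverse of the dual of the
  cartesian arrow \<open>f\<^sup>*E' \<rightarrow> E'\<close>.\<close>

definition op_dual :: "('o, 'm, 'z) rtcat_scheme \<Rightarrow> 'm bmor \<Rightarrow> 'm bmor" where
  "op_dual L d = (let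
      f = bbase d;
      E = bsrc d;
      E' = btgt d;
      v = \<lparr>bsrc = reindex L f E', btgt = E, bbase = Id L (base L E), btop = btop d\<rparr>;
      k = \<lparr>bsrc = reindex L f E', btgt = E', bbase = f, btop = pb2 L f (bprj E')\<rparr>
    in \<lparr>bsrc = bdual_ob L E, btgt = bdual_ob L E', bbase = f,
      btop = btop (vertical_dual L v) ;;\<^bsub>L\<^esub> inv_arrow L (btop (bdual_ar L k)) ;;\<^bsub>L\<^esub>
        pb2 L f (bprj (bdual_ob L E'))\<rparr>)"

locale reverse_tangent_category = tangent_category L
  for L :: "('o, 'm, 'z) rtcat_scheme" (structure) +
  assumes display_differential: "b \<in> display L \<Longrightarrow> differential_bundle L b"
    and display_pullback_preserved:
      "\<lbrakk>b \<in> display L; is_pullback L f (bprj b) a g\<rbrakk> \<Longrightarrow> T_pullback L f (bprj b) a g"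
    and display_pullback_closed:
      "\<lbrakk>b \<in> display L; is_pullback L f (bprj b) a g\<rbrakk> \<Longrightarrow> induced_bundle L f b a g \<in> display L"
    and display_tangent: "A \<in> Ob L \<Longrightarrow> tangent_bundle L A \<in> display L"
    and bdual_functor: "is_functor (DBun L) (DBun_dual L) (bdual_ob L) (bdual_ar L)"
    and bdual_ob_base: "b \<in> display L \<Longrightarrow> base L (bdual_ob L b) = base L b"
    and bdual_ar_base: "e \<in> Ar (DBun L) \<Longrightarrow> bbase (bdual_ar L e) = bbase e"
    and bdual_cartesian: "cartesian (DBun L) L (base L) bbase e
      \<Longrightarrow> cartesian (DBun_dual L) L (base L) bbase (bdual_ar L e)"
    and bdual_iso_iso: "b \<in> display L \<Longrightarrow> iso (DBun L) (bdual_iso L b)"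
    and bdual_iso_base: "b \<in> display L \<Longrightarrow> bbase (bdual_iso L b) = Id L (base L b)"
    and bdual_iso_natural: "nat_trans (DBun L) (DBun L) (\<lambda>b. b) (\<lambda>e. e)
      (\<lambda>b. bdual_ob L (bdual_ob L b)) (\<lambda>e. op_dual L (bdual_ar L e)) (bdual_iso L)"
    and bdual_iso_coherent: "b \<in> display L \<Longrightarrow>
      bdual_iso L (bdual_ob L b) ;;\<^bsub>DBun L\<^esub> vertical_dual L (bdual_iso L b) =
      Id (DBun L) (bdual_ob L b)"

definition cotangent_bundle :: "('o, 'm, 'z) rtcat_scheme \<Rightarrow> 'o \<Rightarrow> 'm dbun" where
  "cotangent_bundle L A = bdual_ob L (tangent_bundle L A)"

definition tangent_mor :: "('o, 'm, 'z) rtcat_scheme \<Rightarrow> 'm \<Rightarrow> 'm bmor" where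
  "tangent_mor L f = \<lparr>bsrc = tangent_bundle L (Dom L f), btgt = tangent_bundle L (Cod L f),
    bbase = f, btop = TAr L f\<rparr>"

definition cotangent_map :: "('o, 'm, 'z) rtcat_scheme \<Rightarrow> 'm \<Rightarrow> 'm" where
  "cotangent_map L f = btop (bdual_ar L (tangent_mor L f))"

end

theory Submission
  imports Defs
begin

text \<open>
  The proof separates a fact about spans from a fact about the involution.

  For spans: composing isomorphism classes agrees with composing arbitrary representatives over an
  arbitrary pullback (lemma \<open>span_comp_span_class\<close>), so each law of \<open>Lens L\<close> reduces to
  exhibiting one convenient pullback. The pasting lemma supplies it, both for the closure of lenses
  under composition, where the right legs of the two spans paste to a pullback along the composite
  base arrow, and for associativity, where the two bracketings share a common apex.

  For the involution: the pairs \<open>(f, Tf)\<close> are linear by naturality of the projection and of the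
  vertical lift, so \<open>A \<mapsto> p\<^sub>A\<close> is a functor from \<open>L\<close> to bundles, and applying the involution gives
  a functor to the dual fibration. It remains to see that an arrow \<open>(f, g)\<close> of the dual fibration
  from \<open>q\<close> to \<open>q'\<close> is a lens, with the span of \<open>g\<close> and the projection \<open>f\<^sup>*q' \<rightarrow> q'\<close>, and that this
  passage respects composition. The point there is that in the composite
  \<open>(f ;; f', f\<^sup>*(g') ;; g)\<close> the arrow \<open>f\<^sup>*(g')\<close> is itself a pullback of \<open>g'\<close>, by the cancellation half
  of the pasting lemma; this is exactly the pullback that composes the two spans
  (lemma \<open>span_comp_reindex\<close>). The comparison isomorphisms \<open>1\<^sup>*q \<simeq> q\<close> and
  \<open>(f ;; f')\<^sup>*q \<simeq> f\<^sup>*(f'\<^sup>*q)\<close>, needed because chosen pullbacks are not strictly functorial,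
  disappear on passing to isomorphism classes of spans.
\<close>

section \<open>Pullbacks and isomorphisms\<close>

context category
begin

lemma Id_Ar [simp]: "a \<in> Ob C \<Longrightarrow> Id C a \<in> Ar C"
  and Dom_Id [simp]: "a \<in> Ob C \<Longrightarrow> Dom C (Id C a) = a"
  and Cod_Id [simp]: "a \<in> Ob C \<Longrightarrow> Cod C (Id C a) = a"
  using Id_hom[of a] by (auto simp: hom_def)

lemma Comp_Ar [simp]: "\<lbrakk>f \<in> Ar C; g \<in> Ar C; Cod C f = Dom C g\<rbrakk> \<Longrightarrow> f ;; g \<in> Ar C"
  and Dom_Comp [simp]: "\<lbrakk>f \<in> Ar C; g \<in> Ar C; Cod C f = Dom C g\<rbrakk> \<Longrightarrow> Dom C (f ;; g) = Dom C f"
  and Cod_Comp [simp]: "\<lbrakk>f \<in> Ar C; g \<in> Ar C; Cod C f = Dom C g\<rbrakk> \<Longrightarrow> Cod C (f ;; g) = Cod C g"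
  using Comp_hom[of f g] by (auto simp: hom_def)

lemmas [simp] = Dom_Ob Cod_Ob Id_left Id_right

lemma Id_left' [simp]: "\<lbrakk>f \<in> Ar C; Dom C f = a\<rbrakk> \<Longrightarrow> Id C a ;; f = f"
  and Id_right' [simp]: "\<lbrakk>f \<in> Ar C; Cod C f = a\<rbrakk> \<Longrightarrow> f ;; Id C a = f"
  using Id_left Id_right by auto

lemma is_pullbackD:
  assumes "is_pullback C f q a b"
  shows "f \<in> Ar C" "q \<in> Ar C" "a \<in> Ar C" "b \<in> Ar C"
    "Cod C f = Cod C q" "Cod C a = Dom C f" "Cod C b = Dom C q" "Dom C a = Dom C b"
    "a ;; f = b ;; q"
  using assms by (auto simp: is_pullback_def)

lemma is_pullback_lift:
  assumes "is_pullback C f q a b" "x \<in> Ar C" "y \<in> Ar C" "Dom C x = Dom C y"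
    "Cod C x = Dom C f" "Cod C y = Dom C q" "x ;; f = y ;; q"
  obtains u where "u \<in> Ar C" "Dom C u = Dom C x" "Cod C u = Dom C a" "u ;; a = x" "u ;; b = y"
  using assms unfolding is_pullback_def hom_def by blast

lemma is_pullback_jointly_monic:
  assumes "is_pullback C f q a b" "u \<in> Ar C" "v \<in> Ar C" "Dom C u = Dom C v"
    "Cod C u = Dom C a" "Cod C v = Dom C a" "u ;; a = v ;; a" "u ;; b = v ;; b"
  shows "u = v"
proof -
  note P = is_pullbackD[OF assms(1)]
  have "(u ;; a) ;; f = (u ;; b) ;; q"
    using P assms(2,5) by (simp add: Comp_assoc)
  moreover have "u ;; a \<in> Ar C" "u ;; b \<in> Ar C" "Dom C (u ;; a) = Dom C (u ;; b)"
    "Cod C (u ;; a) = Dom C f" "Cod C (u ;; b) = Dom C q"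
    using P assms(2,5) by auto
  ultimately have "\<exists>!w. w \<in> hom C (Dom C (u ;; a)) (Dom C a) \<and> w ;; a = u ;; a \<and> w ;; b = u ;; b"
    using assms(1) unfolding is_pullback_def by blast
  then show ?thesis
    using assms P by (auto simp: hom_def)
qed

lemma is_pullbackI:
  assumes "f \<in> Ar C" "q \<in> Ar C" "a \<in> Ar C" "b \<in> Ar C"
    and "Cod C f = Cod C q" "Cod C a = Dom C f" "Cod C b = Dom C q" "Dom C a = Dom C b"
    and "a ;; f = b ;; q"
    and ex: "\<And>x y. \<lbrakk>x \<in> Ar C; y \<in> Ar C; Dom C x = Dom C y; Cod C x = Dom C f;
        Cod C y = Dom C q; x ;; f = y ;; q\<rbrakk>
      \<Longrightarrow> \<exists>u \<in> Ar C. Dom C u = Dom C x \<and> Cod C u = Dom C a \<and> u ;; a = x \<and> u ;; b = y"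
    and un: "\<And>u v. \<lbrakk>u \<in> Ar C; v \<in> Ar C; Dom C u = Dom C v; Cod C u = Dom C a;
        Cod C v = Dom C a; u ;; a = v ;; a; u ;; b = v ;; b\<rbrakk> \<Longrightarrow> u = v"
  shows "is_pullback C f q a b"
  unfolding is_pullback_def
proof (intro conjI ballI impI)
  fix x y
  assume "x \<in> Ar C" "y \<in> Ar C"
    "Dom C x = Dom C y \<and> Cod C x = Dom C f \<and> Cod C y = Dom C q \<and> x ;; f = y ;; q"
  then obtain u where u: "u \<in> hom C (Dom C x) (Dom C a) \<and> u ;; a = x \<and> u ;; b = y"
    using ex[of x y] by (auto simp: hom_def)
  show "\<exists>!u. u \<in> hom C (Dom C x) (Dom C a) \<and> u ;; a = x \<and> u ;; b = y"
  proof (rule ex1I, rule u)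
    fix v assume "v \<in> hom C (Dom C x) (Dom C a) \<and> v ;; a = x \<and> v ;; b = y"
    note v = this
    show "v = u" by (rule un) (use u v in \<open>auto simp: hom_def\<close>)
  qed
qed (use assms in auto)

lemma pair_lift:
  assumes "is_pullback C f q a b" "x \<in> Ar C" "y \<in> Ar C" "Dom C x = Dom C y"
    "Cod C x = Dom C f" "Cod C y = Dom C q" "x ;; f = y ;; q"
  shows "pair C a b x y \<in> Ar C" "Dom C (pair C a b x y) = Dom C x"
    "Cod C (pair C a b x y) = Dom C a" "pair C a b x y ;; a = x" "pair C a b x y ;; b = y"
proof -
  have "\<exists>!u. u \<in> hom C (Dom C x) (Dom C a) \<and> u ;; a = x \<and> u ;; b = y"
    using assms unfolding is_pullback_def by blast
  from theI'[OF this]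
  show "pair C a b x y \<in> Ar C" "Dom C (pair C a b x y) = Dom C x"
    "Cod C (pair C a b x y) = Dom C a" "pair C a b x y ;; a = x" "pair C a b x y ;; b = y"
    by (auto simp: pair_def hom_def)
qed

lemma is_pullback_sym: "is_pullback C f q a b \<Longrightarrow> is_pullback C q f b a"
proof (rule is_pullbackI)
  assume P: "is_pullback C f q a b"
  note D = is_pullbackD[OF P]
  show "q \<in> Ar C" "f \<in> Ar C" "b \<in> Ar C" "a \<in> Ar C" "Cod C q = Cod C f" "Cod C b = Dom C q"
    "Cod C a = Dom C f" "Dom C b = Dom C a" "b ;; q = a ;; f"
    using D by auto
  show "\<exists>u \<in> Ar C. Dom C u = Dom C x \<and> Cod C u = Dom C b \<and> u ;; b = x \<and> u ;; a = y"
    if "x \<in> Ar C" "y \<in> Ar C" "Dom C x = Dom C y" "Cod C x = Dom C q" "Cod C y = Dom C f"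
      "x ;; q = y ;; f" for x y
    using that D is_pullback_lift[OF P, of y x] by metis
  show "u = v" if "u \<in> Ar C" "v \<in> Ar C" "Dom C u = Dom C v" "Cod C u = Dom C b"
    "Cod C v = Dom C b" "u ;; b = v ;; b" "u ;; a = v ;; a" for u v
    using that D is_pullback_jointly_monic[OF P, of u v] by simp
qed

lemma is_pullback_paste:
  assumes R: "is_pullback C f' r a' u" and Q: "is_pullback C f a' a w"
  shows "is_pullback C (f ;; f') r a (w ;; u)"
proof -
  note D = is_pullbackD[OF R] is_pullbackD[OF Q]
  show ?thesis
  proof (rule is_pullbackI)
    have "a ;; (f ;; f') = (w ;; a') ;; f'" using D by (simp flip: Comp_assoc)
    also have "\<dots> = (w ;; u) ;; r" using D by (simp add: Comp_assoc)
    finally show "a ;; (f ;; f') = w ;; u ;; r" .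
  next
    fix x y assume h: "x \<in> Ar C" "y \<in> Ar C" "Dom C x = Dom C y" "Cod C x = Dom C (f ;; f')"
      "Cod C y = Dom C r" "x ;; (f ;; f') = y ;; r"
    then obtain s where s: "s \<in> Ar C" "Dom C s = Dom C x" "Cod C s = Dom C a'" "s ;; a' = x ;; f"
      "s ;; u = y"
      using is_pullback_lift[OF R, of "x ;; f" y] D by (auto simp: Comp_assoc)
    obtain t where "t \<in> Ar C" "Dom C t = Dom C x" "Cod C t = Dom C a" "t ;; a = x" "t ;; w = s"
      using is_pullback_lift[OF Q, of x s] h s D by auto
    then show "\<exists>u'\<in>Ar C. Dom C u' = Dom C x \<and> Cod C u' = Dom C a \<and> u' ;; a = x \<and>
        u' ;; (w ;; u) = y"
      using s D by (intro bexI[of _ t]) (auto simp flip: Comp_assoc)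
  next
    fix s t assume h: "s \<in> Ar C" "t \<in> Ar C" "Dom C s = Dom C t" "Cod C s = Dom C a"
      "Cod C t = Dom C a" "s ;; a = t ;; a" "s ;; (w ;; u) = t ;; (w ;; u)"
    have "(s ;; a) ;; f = (t ;; a) ;; f" using h(6) by simp
    then have eq1: "s ;; w ;; a' = t ;; w ;; a'" using h(1-5) D by (simp add: Comp_assoc)
    have eq2: "s ;; w ;; u = t ;; w ;; u" using h D by (simp add: Comp_assoc)
    have eq: "s ;; w = t ;; w"
      by (rule is_pullback_jointly_monic[OF R _ _ _ _ _ eq1 eq2]) (use h D in auto)
    show "s = t" by (rule is_pullback_jointly_monic[OF Q _ _ _ _ _ _ eq]) (use h in auto)
  qed (use D in auto)
qed

lemma is_pullback_cancel:
  assumes R: "is_pullback C f' r a' u" and Q: "is_pullback C (f ;; f') r a (w ;; u)"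
    and "f \<in> Ar C" "Cod C f = Dom C f'" "w \<in> Ar C" "Cod C w = Dom C a'" "a ;; f = w ;; a'"
  shows "is_pullback C f a' a w"
proof -
  note D = is_pullbackD[OF R] is_pullbackD[OF Q] assms(3-7)
  show ?thesis
  proof (rule is_pullbackI)
    fix x y assume h: "x \<in> Ar C" "y \<in> Ar C" "Dom C x = Dom C y" "Cod C x = Dom C f"
      "Cod C y = Dom C a'" "x ;; f = y ;; a'"
    have "x ;; (f ;; f') = y ;; a' ;; f'" using h D by (simp flip: Comp_assoc)
    then have "x ;; (f ;; f') = y ;; u ;; r" using h D by (simp add: Comp_assoc)
    then obtain t where t: "t \<in> Ar C" "Dom C t = Dom C x" "Cod C t = Dom C a" "t ;; a = x"
        "t ;; (w ;; u) = y ;; u"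
      using is_pullback_lift[OF Q, of x "y ;; u"] h D by auto
    have "t ;; w ;; a' = t ;; a ;; f" using t(1-3) D by (simp add: Comp_assoc)
    also have "\<dots> = y ;; a'" using t h by simp
    finally have eq: "t ;; w ;; a' = y ;; a'" .
    have "t ;; w = y"
      by (rule is_pullback_jointly_monic[OF R _ _ _ _ _ eq]) (use t h D in \<open>auto simp: Comp_assoc\<close>)
    then show "\<exists>u'\<in>Ar C. Dom C u' = Dom C x \<and> Cod C u' = Dom C a \<and> u' ;; a = x \<and> u' ;; w = y"
      using t by blast
  next
    fix s t assume h: "s \<in> Ar C" "t \<in> Ar C" "Dom C s = Dom C t" "Cod C s = Dom C a"
      "Cod C t = Dom C a" "s ;; a = t ;; a" "s ;; w = t ;; w"
    have "s ;; w ;; u = t ;; w ;; u" using h by simp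
    then have eq: "s ;; (w ;; u) = t ;; (w ;; u)" using h(1-5) D by (simp add: Comp_assoc)
    show "s = t"
      by (rule is_pullback_jointly_monic[OF Q _ _ _ _ _ _ eq]) (use h(1-6) D in \<open>auto simp: Comp_assoc\<close>)
  qed (use D in auto)
qed

lemma iso_Ar [simp]: "iso C i \<Longrightarrow> i \<in> Ar C"
  by (auto simp: iso_def inverse_arrows_def)

lemma isoE:
  assumes "iso C i"
  obtains j where "iso C j" "j \<in> Ar C" "Dom C j = Cod C i" "Cod C j = Dom C i"
    "i ;; j = Id C (Dom C i)" "j ;; i = Id C (Cod C i)"
proof -
  obtain j where ij: "inverse_arrows C i j" using assms by (auto simp: iso_def)
  then have "inverse_arrows C j i" by (auto simp: inverse_arrows_def hom_def)
  with ij show thesis using that unfolding iso_def inverse_arrows_def hom_def by blast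
qed

lemma iso_Id [simp]: "a \<in> Ob C \<Longrightarrow> iso C (Id C a)"
  unfolding iso_def by (rule exI[of _ "Id C a"]) (simp add: inverse_arrows_def hom_def)

lemma iso_Comp:
  assumes "iso C i" "iso C j" "Cod C i = Dom C j"
  shows "iso C (i ;; j)"
proof -
  obtain i' where i': "i' \<in> Ar C" "Dom C i' = Cod C i" "Cod C i' = Dom C i"
    "i ;; i' = Id C (Dom C i)" "i' ;; i = Id C (Cod C i)"
    using isoE[OF assms(1)] by metis
  obtain j' where j': "j' \<in> Ar C" "Dom C j' = Cod C j" "Cod C j' = Dom C j"
    "j ;; j' = Id C (Dom C j)" "j' ;; j = Id C (Cod C j)"
    using isoE[OF assms(2)] by metis
  note A = iso_Ar[OF assms(1)] iso_Ar[OF assms(2)]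
  have "(i ;; j) ;; (j' ;; i') = i ;; ((j ;; j') ;; i')"
    using A assms(3) i'(1-3) j'(1-3) by (simp add: Comp_assoc)
  moreover have "(j' ;; i') ;; (i ;; j) = j' ;; ((i' ;; i) ;; j)"
    using A assms(3) i'(1-3) j'(1-3) by (simp add: Comp_assoc)
  ultimately show ?thesis
    unfolding iso_def inverse_arrows_def hom_def using A assms(3) i' j'
    by (intro exI[of _ "j' ;; i'"]) simp
qed

lemma is_pullback_iso_apex:
  assumes P: "is_pullback C f q a b" and i: "iso C i" "Cod C i = Dom C a"
  shows "is_pullback C f q (i ;; a) (i ;; b)"
proof -
  note D = is_pullbackD[OF P] iso_Ar[OF i(1)] i(2)
  obtain j where j: "j \<in> Ar C" "Dom C j = Cod C i" "Cod C j = Dom C i"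
    "i ;; j = Id C (Dom C i)" "j ;; i = Id C (Cod C i)"
    using isoE[OF i(1)] by metis
  show ?thesis
  proof (rule is_pullbackI)
    fix x y assume "x \<in> Ar C" "y \<in> Ar C" "Dom C x = Dom C y" "Cod C x = Dom C f"
      "Cod C y = Dom C q" "x ;; f = y ;; q"
    then obtain u where u: "u \<in> Ar C" "Dom C u = Dom C x" "Cod C u = Dom C a" "u ;; a = x" "u ;; b = y"
      using is_pullback_lift[OF P] by metis
    have "u ;; j ;; i = u" using u j D by (simp add: Comp_assoc)
    then have "u ;; j ;; (i ;; a) = x" "u ;; j ;; (i ;; b) = y"
      using u j D Comp_assoc[of "u ;; j" i a] Comp_assoc[of "u ;; j" i b] by simp_all
    then show "\<exists>u\<in>Ar C. Dom C u = Dom C x \<and> Cod C u = Dom C (i ;; a) \<and> u ;; (i ;; a) = x \<and>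
        u ;; (i ;; b) = y"
      using u j D by (intro bexI[of _ "u ;; j"]) auto
  next
    fix u v assume h: "u \<in> Ar C" "v \<in> Ar C" "Dom C u = Dom C v" "Cod C u = Dom C (i ;; a)"
      "Cod C v = Dom C (i ;; a)" "u ;; (i ;; a) = v ;; (i ;; a)" "u ;; (i ;; b) = v ;; (i ;; b)"
    have "u ;; i = v ;; i"
      by (-, rule is_pullback_jointly_monic[OF P]) (use h D in \<open>auto simp: Comp_assoc\<close>)
    then have "u ;; i ;; j = v ;; i ;; j" by simp
    then show "u = v" using h(1-5) D j by (simp add: Comp_assoc)
  qed (use D in \<open>auto simp: Comp_assoc\<close>)
qed

lemma is_pullback_comparison:
  assumes P: "is_pullback C f q a b" and Q: "is_pullback C f q a' b'"
  obtains i where "iso C i" "Dom C i = Dom C a'" "Cod C i = Dom C a" "i ;; a = a'" "i ;; b = b'"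
proof -
  note D = is_pullbackD[OF P] is_pullbackD[OF Q]
  obtain i where i: "i \<in> Ar C" "Dom C i = Dom C a'" "Cod C i = Dom C a" "i ;; a = a'" "i ;; b = b'"
    using is_pullback_lift[OF P, of a' b'] D by metis
  obtain j where j: "j \<in> Ar C" "Dom C j = Dom C a" "Cod C j = Dom C a'" "j ;; a' = a" "j ;; b' = b"
    using is_pullback_lift[OF Q, of a b] D by metis
  have "i ;; j = Id C (Dom C a')"
    by (rule is_pullback_jointly_monic[OF Q]) (use D i j in \<open>auto simp: Comp_assoc\<close>)
  moreover have "j ;; i = Id C (Dom C a)"
    by (rule is_pullback_jointly_monic[OF P]) (use D i j in \<open>auto simp: Comp_assoc\<close>)
  ultimately have "iso C i"
    using i j unfolding iso_def inverse_arrows_def hom_def by (intro exI[of _ j]) auto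
  with i show thesis using that by blast
qed

lemma iso_pair:
  assumes P: "is_pullback C f q a b" and Q: "is_pullback C f q a' b'"
  shows "iso C (pair C a b a' b')"
proof -
  note D = is_pullbackD[OF P] is_pullbackD[OF Q]
  obtain i where i: "iso C i" "Dom C i = Dom C a'" "Cod C i = Dom C a" "i ;; a = a'" "i ;; b = b'"
    using is_pullback_comparison[OF P Q] .
  have "pair C a b a' b' = i"
    by (rule is_pullback_jointly_monic[OF P])
      (use pair_lift[OF P D(12,13,17,15,16,18)] i in auto)
  with i show ?thesis by simp
qed

lemma is_pullback_Id:
  assumes "q \<in> Ar C"
  shows "is_pullback C (Id C (Cod C q)) q q (Id C (Dom C q))"
proof (rule is_pullbackI)
  show "\<exists>u \<in> Ar C. Dom C u = Dom C x \<and> Cod C u = Dom C q \<and> u ;; q = x \<and>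
      u ;; Id C (Dom C q) = y"
    if "y \<in> Ar C" "Dom C x = Dom C y" "Cod C y = Dom C q" "x \<in> Ar C"
      "Cod C x = Dom C (Id C (Cod C q))" "x ;; Id C (Cod C q) = y ;; q" for x y
    using that assms by (intro bexI[of _ y]) auto
qed (use assms in auto)

lemma is_pullback_Id_iso:
  assumes "is_pullback C (Id C (Cod C q)) q a b"
  shows "iso C b"
proof -
  have q: "q \<in> Ar C" using is_pullbackD(2)[OF assms] .
  obtain i where "iso C i" "Cod C i = Dom C q" "i ;; Id C (Dom C q) = b"
    using is_pullback_comparison[OF is_pullback_Id[OF q] assms] .
  then show ?thesis by simp
qed


section \<open>Isomorphism classes of spans\<close>

lemma span_class_self:
  assumes "F \<in> Ar C" "u \<in> Ar C" "Dom C F = Dom C u"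
  shows "(F, u) \<in> span_class C F u"
  unfolding span_class_def using assms by (auto intro!: exI[of _ "Id C (Dom C u)"])

lemma span_class_iso_apex:
  assumes "iso C l" "Cod C l = Dom C F" "F \<in> Ar C" "u \<in> Ar C" "Dom C F = Dom C u"
  shows "span_class C (l ;; F) (l ;; u) = span_class C F u"
proof -
  obtain j where j: "iso C j" "j \<in> Ar C" "Dom C j = Cod C l" "Cod C j = Dom C l"
    "l ;; j = Id C (Dom C l)" "j ;; l = Id C (Cod C l)"
    using isoE[OF assms(1)] .
  have "\<exists>i'. i ;; (l ;; F) = i' ;; F \<and> i ;; (l ;; u) = i' ;; u \<and> iso C i' \<and> Cod C i' = Dom C F"
    if "iso C i" "Cod C i = Dom C l" for i
    using that assms by (intro exI[of _ "i ;; l"]) (auto simp: iso_Comp Comp_assoc)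
  moreover have "\<exists>i'. i ;; F = i' ;; (l ;; F) \<and> i ;; u = i' ;; (l ;; u) \<and> iso C i' \<and>
      Cod C i' = Dom C l"
    if i: "iso C i" "Cod C i = Dom C F" for i
  proof (intro exI[of _ "i ;; j"] conjI)
    have "i ;; j ;; l = i" using i j assms by (simp add: Comp_assoc)
    then show "i ;; F = i ;; j ;; (l ;; F)" "i ;; u = i ;; j ;; (l ;; u)"
      using i j assms Comp_assoc[of "i ;; j" l F] Comp_assoc[of "i ;; j" l u] by simp_all
  qed (use i j assms in \<open>auto simp: iso_Comp\<close>)
  ultimately show ?thesis
    unfolding span_class_def using assms by fastforce
qed

text \<open>Replacing the two spans by isomorphic ones changes the cospan of inner legs by isomorphisms,
  which can be absorbed into the projections of any pullback of it; what is left is a comparison of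
  two pullbacks of the same cospan.\<close>

lemma span_comp_span_class:
  assumes P: "is_pullback C u F' k k'"
    and "F \<in> Ar C" "Dom C F = Dom C u" "u' \<in> Ar C" "Dom C u' = Dom C F'"
  shows "span_comp C (span_class C F u) (span_class C F' u') = span_class C (k ;; F) (k' ;; u')"
    (is "?L = ?R")
proof
  note D = is_pullbackD[OF P] assms(2-)
  show "?R \<subseteq> ?L"
  proof
    fix z assume "z \<in> ?R"
    then obtain l where l: "iso C l" "Cod C l = Dom C k" and z: "z = (l ;; (k ;; F), l ;; (k' ;; u'))"
      using D by (auto simp: span_class_def)
    have "(F, u) \<in> span_class C F u" "(F', u') \<in> span_class C F' u'"
      using D by (auto intro: span_class_self)
    moreover have "is_pullback C u F' (l ;; k) (l ;; k')"
      using is_pullback_iso_apex[OF P l] .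
    moreover have "z = (l ;; k ;; F, l ;; k' ;; u')"
      using l D by (simp add: z Comp_assoc)
    ultimately show "z \<in> ?L"
      unfolding span_comp_def by blast
  qed
  show "?L \<subseteq> ?R"
  proof
    fix z assume "z \<in> ?L"
    then obtain i j m m' where i: "iso C i" "Cod C i = Dom C u" and j: "iso C j" "Cod C j = Dom C F'"
      and M: "is_pullback C (i ;; u) (j ;; F') m m'"
      and z: "z = (m ;; (i ;; F), m' ;; (j ;; u'))"
      using D unfolding span_comp_def span_class_def by auto
    note E = is_pullbackD(3-)[OF M] iso_Ar[OF i(1)] iso_Ar[OF j(1)] i(2) j(2)
    have "is_pullback C u F' (m ;; i) (m' ;; j)"
    proof -
      obtain i' where i': "i' \<in> Ar C" "Dom C i' = Cod C i" "Cod C i' = Dom C i"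
        "i ;; i' = Id C (Dom C i)" "i' ;; i = Id C (Cod C i)"
        using isoE[OF i(1)] by metis
      obtain j' where j': "j' \<in> Ar C" "Dom C j' = Cod C j" "Cod C j' = Dom C j"
        "j ;; j' = Id C (Dom C j)" "j' ;; j = Id C (Cod C j)"
        using isoE[OF j(1)] by metis
      show ?thesis
      proof (rule is_pullbackI)
        show "m ;; i ;; u = m' ;; j ;; F'"
          using E D by (simp add: Comp_assoc)
      next
        fix x y assume h: "x \<in> Ar C" "y \<in> Ar C" "Dom C x = Dom C y" "Cod C x = Dom C u"
          "Cod C y = Dom C F'" "x ;; u = y ;; F'"
        have xi: "x ;; i' ;; i = x" and yj: "y ;; j' ;; j = y"
          using h i' j' E D by (simp_all add: Comp_assoc)
        have "x ;; i' ;; (i ;; u) = y ;; j' ;; (j ;; F')"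
          using h i' j' E D xi yj Comp_assoc[of "x ;; i'" i u] Comp_assoc[of "y ;; j'" j F'] by simp
        then obtain t where t: "t \<in> Ar C" "Dom C t = Dom C x" "Cod C t = Dom C m"
            "t ;; m = x ;; i'" "t ;; m' = y ;; j'"
          using is_pullback_lift[OF M, of "x ;; i'" "y ;; j'"] h i' j' E D by auto
        have "t ;; (m ;; i) = x" "t ;; (m' ;; j) = y"
          using t E D xi yj Comp_assoc[of t m i] Comp_assoc[of t m' j] by simp_all
        then show "\<exists>t\<in>Ar C. Dom C t = Dom C x \<and> Cod C t = Dom C (m ;; i) \<and> t ;; (m ;; i) = x \<and>
            t ;; (m' ;; j) = y"
          using t E D by (intro bexI[of _ t]) auto
      next
        fix s t assume h: "s \<in> Ar C" "t \<in> Ar C" "Dom C s = Dom C t" "Cod C s = Dom C (m ;; i)"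
          "Cod C t = Dom C (m ;; i)" "s ;; (m ;; i) = t ;; (m ;; i)"
          "s ;; (m' ;; j) = t ;; (m' ;; j)"
        have "s ;; (m ;; i) ;; i' = t ;; (m ;; i) ;; i'" "s ;; (m' ;; j) ;; j' = t ;; (m' ;; j) ;; j'"
          using h by simp_all
        then have eq: "s ;; m = t ;; m" "s ;; m' = t ;; m'"
          using h(1-5) i' j' E D by (simp_all add: Comp_assoc)
        show "s = t"
          by (rule is_pullback_jointly_monic[OF M _ _ _ _ _ eq]) (use h(1-5) E D in auto)
      qed (use E D in auto)
    qed
    from is_pullback_comparison[OF P this] obtain l where
      l: "iso C l" "Cod C l = Dom C k" "l ;; k = m ;; i" "l ;; k' = m' ;; j" .
    have "z = (l ;; (k ;; F), l ;; (k' ;; u'))"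
      using D E l Comp_assoc[of l k F] Comp_assoc[of l k' u'] by (simp add: z Comp_assoc)
    then show "z \<in> ?R"
      unfolding span_class_def using l D by auto
  qed
qed

end


section \<open>Lenses form a category\<close>

lemma Lens_simps [simp]:
  "Ob (Lens C) = Ar C" "Ar (Lens C) = lens_arrows C" "Dom (Lens C) = lsrc" "Cod (Lens C) = ltgt"
  "Id (Lens C) p = \<lparr>lsrc = p, ltgt = p, lbase = Id C (Cod C p),
    lspan = span_class C (Id C (Dom C p)) (Id C (Dom C p))\<rparr>"
  "m ;;\<^bsub>Lens C\<^esub> n = \<lparr>lsrc = lsrc m, ltgt = ltgt n, lbase = lbase m ;;\<^bsub>C\<^esub> lbase n,
    lspan = span_comp C (lspan m) (lspan n)\<rparr>"
  by (simp_all add: Lens_def)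

context category
begin

lemma lens_arrowsE:
  assumes "m \<in> lens_arrows C"
  obtains F u where "is_pullback C (lbase m) (ltgt m) (F ;; lsrc m) u" "F \<in> Ar C"
    "Dom C F = Dom C u" "Cod C F = Dom C (lsrc m)" "lspan m = span_class C F u"
    "lsrc m \<in> Ar C" "ltgt m \<in> Ar C" "lbase m \<in> Ar C"
    "Dom C (lbase m) = Cod C (lsrc m)" "Cod C (lbase m) = Cod C (ltgt m)"
    "u \<in> Ar C" "Cod C u = Dom C (ltgt m)"
  using assms by (fastforce simp: lens_arrows_def hom_def dest: is_pullbackD)

lemma lens_arrowsI:
  assumes "is_pullback C f q (F ;; p) u" "F \<in> Ar C" "p \<in> Ar C" "Cod C F = Dom C p"
  shows "\<lparr>lsrc = p, ltgt = q, lbase = f, lspan = span_class C F u\<rparr> \<in> lens_arrows C"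
proof -
  have "f \<in> hom C (Cod C p) (Cod C q)" "q \<in> Ar C" "F \<in> hom C (Dom C (F ;; p)) (Dom C p)"
    using is_pullbackD[OF assms(1)] assms(2-) by (auto simp: hom_def)
  then show ?thesis
    using assms unfolding lens_arrows_def
    by simp (rule exI[of _ "F ;; p"], rule exI[of _ u], auto)
qed

end

context category_with_pullbacks
begin

text \<open>The outer rectangle of the two base squares and the square composing the spans is a pullback
  along the composite base arrow.\<close>

lemma lens_comp:
  assumes m: "m \<in> lens_arrows C" and n: "n \<in> lens_arrows C" and mn: "ltgt m = lsrc n"
  shows "m ;;\<^bsub>Lens C\<^esub> n \<in> lens_arrows C"
proof -
  obtain F u where 1: "is_pullback C (lbase m) (ltgt m) (F ;; lsrc m) u" "F \<in> Ar C"
    "Dom C F = Dom C u" "Cod C F = Dom C (lsrc m)" "lspan m = span_class C F u"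
    "lsrc m \<in> Ar C" "ltgt m \<in> Ar C" "lbase m \<in> Ar C"
    "Dom C (lbase m) = Cod C (lsrc m)" "Cod C (lbase m) = Cod C (ltgt m)"
    "u \<in> Ar C" "Cod C u = Dom C (ltgt m)"
    using lens_arrowsE[OF m] .
  obtain F' u' where 2: "is_pullback C (lbase n) (ltgt n) (F' ;; lsrc n) u'" "F' \<in> Ar C"
    "Dom C F' = Dom C u'" "Cod C F' = Dom C (lsrc n)" "lspan n = span_class C F' u'"
    "lsrc n \<in> Ar C" "ltgt n \<in> Ar C" "lbase n \<in> Ar C"
    "Dom C (lbase n) = Cod C (lsrc n)" "Cod C (lbase n) = Cod C (ltgt n)"
    "u' \<in> Ar C" "Cod C u' = Dom C (ltgt n)"
    using lens_arrowsE[OF n] .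
  obtain k k' where K: "is_pullback C u F' k k'"
    using pullbacks[of u F'] 1 2 mn by auto
  note D = is_pullbackD[OF K]
  have "is_pullback C (lbase m) (F' ;; lsrc n) (k ;; (F ;; lsrc m)) k'"
    using is_pullback_sym[OF is_pullback_paste[OF is_pullback_sym[OF 1(1)] is_pullback_sym[OF K]]] mn
    by simp
  from is_pullback_paste[OF 2(1) this]
  have "is_pullback C (lbase m ;; lbase n) (ltgt n) (k ;; F ;; lsrc m) (k' ;; u')"
    using 1(2-) D by (simp add: Comp_assoc)
  moreover have "lspan (m ;;\<^bsub>Lens C\<^esub> n) = span_class C (k ;; F) (k' ;; u')"
    using span_comp_span_class[OF K] 1(2-) 2(2-) by simp
  ultimately show ?thesis
    using lens_arrowsI[of "lbase m ;; lbase n" "ltgt n" "k ;; F" "lsrc m" "k' ;; u'"] 1(2-) D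
    by simp
qed

text \<open>The pullbacks \<open>(a, b)\<close> and \<open>(c, d)\<close> composing consecutive spans meet in a third
  pullback, whose apex serves both bracketings.\<close>

lemma span_comp_assoc:
  assumes 1: "F1 \<in> Ar C" "u1 \<in> Ar C" "Dom C F1 = Dom C u1"
    and 2: "F2 \<in> Ar C" "u2 \<in> Ar C" "Dom C F2 = Dom C u2"
    and 3: "F3 \<in> Ar C" "u3 \<in> Ar C" "Dom C F3 = Dom C u3"
    and c: "Cod C u1 = Cod C F2" "Cod C u2 = Cod C F3"
  defines "X \<equiv> span_class C F1 u1" and "Y \<equiv> span_class C F2 u2" and "Z \<equiv> span_class C F3 u3"
  shows "span_comp C (span_comp C X Y) Z = span_comp C X (span_comp C Y Z)"
proof -
  obtain a b where ab: "is_pullback C u1 F2 a b" using pullbacks 1 2 c by blast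
  obtain c d where cd: "is_pullback C u2 F3 c d" using pullbacks 2 3 c by blast
  note D = is_pullbackD[OF ab] is_pullbackD[OF cd]
  obtain s t where st: "is_pullback C b c s t" using pullbacks[of b c] D 2 by auto
  note E = is_pullbackD[OF st]
  have XY: "span_comp C X Y = span_class C (a ;; F1) (b ;; u2)"
    unfolding X_def Y_def using 1 2 by (intro span_comp_span_class[OF ab]) auto
  have YZ: "span_comp C Y Z = span_class C (c ;; F2) (d ;; u3)"
    unfolding Y_def Z_def using 2 3 by (intro span_comp_span_class[OF cd]) auto
  have "span_comp C (span_comp C X Y) Z = span_class C (s ;; (a ;; F1)) (t ;; d ;; u3)"
    unfolding XY Z_def using 1 2 3 D
    by (intro span_comp_span_class[OF is_pullback_paste[OF cd st]]) auto
  moreover have "span_comp C X (span_comp C Y Z) = span_class C (s ;; a ;; F1) (t ;; (d ;; u3))"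
    unfolding YZ X_def using 1 2 3 D
    by (intro span_comp_span_class[OF is_pullback_sym[OF is_pullback_paste[OF is_pullback_sym[OF ab]
      is_pullback_sym[OF st]]]]) auto
  ultimately show ?thesis using 1 3 D E by (simp add: Comp_assoc)
qed

lemma category_Lens: "category (Lens C)"
proof
  fix p assume p: "p \<in> Ob (Lens C)"
  have "is_pullback C (Id C (Cod C p)) p (Id C (Dom C p) ;; p) (Id C (Dom C p))"
    using is_pullback_Id[of p] p by simp
  from lens_arrowsI[OF this] show "Id (Lens C) p \<in> hom (Lens C) p p"
    using p by (simp add: hom_def)
next
  fix m n assume "m \<in> Ar (Lens C)" "n \<in> Ar (Lens C)" "Cod (Lens C) m = Dom (Lens C) n"
  then show "m ;;\<^bsub>Lens C\<^esub> n \<in> hom (Lens C) (Dom (Lens C) m) (Cod (Lens C) n)"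
    using lens_comp[of m n] by (simp add: hom_def)
next
  fix m assume "m \<in> Ar (Lens C)"
  then obtain F u where 1: "F \<in> Ar C"
    "Dom C F = Dom C u" "Cod C F = Dom C (lsrc m)" "lspan m = span_class C F u"
    "lsrc m \<in> Ar C" "ltgt m \<in> Ar C" "lbase m \<in> Ar C"
    "Dom C (lbase m) = Cod C (lsrc m)" "Cod C (lbase m) = Cod C (ltgt m)"
    "u \<in> Ar C" "Cod C u = Dom C (ltgt m)"
    using lens_arrowsE[of m] by (metis Lens_simps(2))
  have "span_comp C (span_class C (Id C (Cod C F)) (Id C (Cod C F))) (span_class C F u) =
      span_class C (F ;; Id C (Cod C F)) (Id C (Dom C F) ;; u)"
    using 1 by (intro span_comp_span_class is_pullback_Id) auto
  then show "Id (Lens C) (Dom (Lens C) m) ;;\<^bsub>Lens C\<^esub> m = m"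
    using 1 by simp
  have "span_comp C (span_class C F u) (span_class C (Id C (Cod C u)) (Id C (Cod C u))) =
      span_class C (Id C (Dom C u) ;; F) (u ;; Id C (Cod C u))"
    using 1 by (intro span_comp_span_class is_pullback_sym[OF is_pullback_Id]) auto
  then show "m ;;\<^bsub>Lens C\<^esub> Id (Lens C) (Cod (Lens C) m) = m"
    using 1 by simp
next
  fix m n l
  assume h: "m \<in> Ar (Lens C)" "n \<in> Ar (Lens C)" "l \<in> Ar (Lens C)"
    "Cod (Lens C) m = Dom (Lens C) n" "Cod (Lens C) n = Dom (Lens C) l"
  obtain F u where 1: "F \<in> Ar C" "u \<in> Ar C" "Dom C F = Dom C u" "lspan m = span_class C F u"
    "Cod C u = Dom C (ltgt m)"
    using lens_arrowsE[of m] h by (metis Lens_simps(2))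
  obtain F' u' where 2: "F' \<in> Ar C" "u' \<in> Ar C" "Dom C F' = Dom C u'"
    "lspan n = span_class C F' u'" "Cod C F' = Dom C (lsrc n)" "Cod C u' = Dom C (ltgt n)"
    using lens_arrowsE[of n] h by (metis Lens_simps(2))
  obtain F'' u'' where 3: "F'' \<in> Ar C" "u'' \<in> Ar C" "Dom C F'' = Dom C u''"
    "lspan l = span_class C F'' u''" "Cod C F'' = Dom C (lsrc l)"
    using lens_arrowsE[of l] h by (metis Lens_simps(2))
  have "lbase m ;; lbase n ;; lbase l = lbase m ;; (lbase n ;; lbase l)"
    by (rule Comp_assoc) (use h in \<open>auto simp: lens_arrows_def hom_def\<close>)
  then show "m ;;\<^bsub>Lens C\<^esub> n ;;\<^bsub>Lens C\<^esub> l = m ;;\<^bsub>Lens C\<^esub> (n ;;\<^bsub>Lens C\<^esub> l)"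
    using h 1 2 3 by (simp add: span_comp_assoc)
qed (auto simp: lens_arrows_def)


section \<open>Composition in the dual fibration as composition of spans\<close>

text \<open>The square with sides \<open>f\<^sup>*(g)\<close> and \<open>g\<close> is the upper half of a rectangle whose lower half is
  the pullback of \<open>q\<close> along \<open>f\<close> and whose outline is the pullback of \<open>f'\<^sup>*r\<close> along \<open>f\<close>. Hence it is
  a pullback, and it computes the composite span up to the comparison \<open>reindex_comp\<close>.\<close>

lemma span_comp_reindex:
  assumes f: "f \<in> Ar C" "f' \<in> Ar C" "Cod C f = Dom C f'"
    and qr: "q \<in> Ar C" "Cod C q = Cod C f" "r \<in> Ar C" "Cod C r = Cod C f'"
    and g: "g \<in> Ar C" "Dom C g = Dom C (pb1 C f' r)" "Cod C g = Dom C q" "g ;; q = pb1 C f' r"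
    and F: "F \<in> Ar C" "Dom C F = Dom C (pb1 C f q)"
  shows "span_comp C (span_class C F (pb2 C f q)) (span_class C g (pb2 C f' r)) =
    span_class C (reindex_comp C f f' r ;; reindex_ar C f (pb1 C f' r) q g ;; F)
      (pb2 C (f ;; f') r)"
proof -
  define r' where "r' = pb1 C f' r"
  define \<pi>1 where "\<pi>1 = pb1 C f r'"
  define \<pi>2 where "\<pi>2 = pb2 C f r'"
  define s where "s = reindex_ar C f r' q g"
  define l where "l = reindex_comp C f f' r"
  have Q: "is_pullback C f q (pb1 C f q) (pb2 C f q)" using pullbacks f qr by simp
  have R: "is_pullback C f' r r' (pb2 C f' r)" unfolding r'_def using pullbacks f qr by simp
  note QR = is_pullbackD[OF Q] is_pullbackD[OF R]
  have P: "is_pullback C f r' \<pi>1 \<pi>2"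
    unfolding \<pi>1_def \<pi>2_def using pullbacks f QR by simp
  have O: "is_pullback C (f ;; f') r (pb1 C (f ;; f') r) (pb2 C (f ;; f') r)"
    using pullbacks f qr by simp
  note D = QR is_pullbackD[OF P] is_pullbackD[OF O]
  have g': "Dom C g = Dom C r'" "g ;; q = r'" using g by (simp_all add: r'_def)
  have "\<pi>1 ;; f = \<pi>2 ;; g ;; q" using D g g' by (simp add: Comp_assoc)
  from pair_lift[OF Q _ _ _ _ _ this]
  have s: "s \<in> Ar C" "Dom C s = Dom C \<pi>1" "Cod C s = Dom C (pb1 C f q)"
    "s ;; pb1 C f q = \<pi>1" "s ;; pb2 C f q = \<pi>2 ;; g"
    unfolding s_def reindex_ar_def \<pi>1_def[symmetric] \<pi>2_def[symmetric] using D g(1,3) g' by auto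
  have "is_pullback C (pb2 C f q) g s \<pi>2"
  proof (rule is_pullback_sym, rule is_pullback_cancel[OF is_pullback_sym[OF Q]])
    show "is_pullback C (g ;; q) f \<pi>2 (s ;; pb1 C f q)"
      using is_pullback_sym[OF P] s g' by simp
  qed (use D s g g' in auto)
  then have *: "span_comp C (span_class C F (pb2 C f q)) (span_class C g (pb2 C f' r)) =
      span_class C (s ;; F) (\<pi>2 ;; pb2 C f' r)"
    using F D g' by (intro span_comp_span_class) auto
  define w where "w = pair C r' (pb2 C f' r) (pb1 C (f ;; f') r ;; f) (pb2 C (f ;; f') r)"
  have l_eq: "l = pair C \<pi>1 \<pi>2 (pb1 C (f ;; f') r) w"
    by (simp add: l_def reindex_comp_def w_def \<pi>1_def \<pi>2_def r'_def)
  have "pb1 C (f ;; f') r ;; f ;; f' = pb2 C (f ;; f') r ;; r"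
    using D f by (simp add: Comp_assoc)
  from pair_lift[OF R _ _ _ _ _ this]
  have w: "w \<in> Ar C" "Dom C w = Dom C (pb1 C (f ;; f') r)" "Cod C w = Dom C r'"
    "w ;; r' = pb1 C (f ;; f') r ;; f" "w ;; pb2 C f' r = pb2 C (f ;; f') r"
    unfolding w_def using D f by auto
  have OW: "is_pullback C f r' (pb1 C (f ;; f') r) w"
    using is_pullback_cancel[OF R, of f "pb1 C (f ;; f') r" w] O w f D by simp
  have l: "iso C l" "l \<in> Ar C" "Cod C l = Dom C \<pi>1" "l ;; \<pi>2 = w"
    using iso_pair[OF P OW] pair_lift[OF P, of "pb1 C (f ;; f') r" w] is_pullbackD[OF OW] f
    by (auto simp: l_eq)
  have "l ;; (\<pi>2 ;; pb2 C f' r) = pb2 C (f ;; f') r"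
    using l w D Comp_assoc[of l \<pi>2 "pb2 C f' r"] by simp
  moreover have "l ;; (s ;; F) = l ;; s ;; F"
    using l s F by (simp add: Comp_assoc)
  moreover have "span_class C (l ;; (s ;; F)) (l ;; (\<pi>2 ;; pb2 C f' r)) =
      span_class C (s ;; F) (\<pi>2 ;; pb2 C f' r)"
    by (rule span_class_iso_apex) (use l s F D in auto)
  ultimately show ?thesis
    unfolding * by (simp add: l_def s_def r'_def)
qed

end


section \<open>The cotangent functor\<close>

lemma is_functorD:
  assumes "is_functor C D Fo Fa"
  shows "a \<in> Ob C \<Longrightarrow> Fo a \<in> Ob D"
    "f \<in> Ar C \<Longrightarrow> Fa f \<in> hom D (Fo (Dom C f)) (Fo (Cod C f))"
    "a \<in> Ob C \<Longrightarrow> Fa (Id C a) = Id D (Fo a)"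
    "\<lbrakk>f \<in> Ar C; g \<in> Ar C; Cod C f = Dom C g\<rbrakk> \<Longrightarrow> Fa (f ;;\<^bsub>C\<^esub> g) = Fa f ;;\<^bsub>D\<^esub> Fa g"
  using assms by (simp_all add: is_functor_def)

lemma DBun_simps [simp]:
  "Ob (DBun L) = display L" "Dom (DBun L) = bsrc" "Cod (DBun L) = btgt"
  "e \<in> Ar (DBun L) \<longleftrightarrow> bsrc e \<in> display L \<and> btgt e \<in> display L \<and>
    linear_morphism L (bsrc e) (btgt e) (bbase e) (btop e)"
  "Id (DBun L) b = \<lparr>bsrc = b, btgt = b, bbase = Id L (base L b), btop = Id L (total L b)\<rparr>"
  "e ;;\<^bsub>DBun L\<^esub> e' = \<lparr>bsrc = bsrc e, btgt = btgt e', bbase = bbase e ;;\<^bsub>L\<^esub> bbase e',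
      btop = btop e ;;\<^bsub>L\<^esub> btop e'\<rparr>"
  by (simp_all add: DBun_def)

lemma DBun_dual_simps [simp]:
  "Ob (DBun_dual L) = display L" "Dom (DBun_dual L) = bsrc" "Cod (DBun_dual L) = btgt"
  by (simp_all add: DBun_dual_def)

context reverse_tangent_category
begin

lemma TAr_hom [simp]:
  "f \<in> Ar L \<Longrightarrow> TAr L f \<in> Ar L"
  "f \<in> Ar L \<Longrightarrow> Dom L (TAr L f) = TOb L (Dom L f)"
  "f \<in> Ar L \<Longrightarrow> Cod L (TAr L f) = TOb L (Cod L f)"
  using is_functorD(2)[OF T_functor, of f] by (auto simp: hom_def)

lemma tp_hom [simp]:
  "A \<in> Ob L \<Longrightarrow> tp L A \<in> Ar L"
  "A \<in> Ob L \<Longrightarrow> Dom L (tp L A) = TOb L A"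
  "A \<in> Ob L \<Longrightarrow> Cod L (tp L A) = A"
  using tp_natural by (auto simp: nat_trans_def hom_def)

lemma tangent_bundle_sel [simp]:
  "bprj (tangent_bundle L A) = tp L A" "blift (tangent_bundle L A) = tlift L A"
  by (simp_all add: tangent_bundle_def)

lemma tangent_mor_sel [simp]:
  "bsrc (tangent_mor L f) = tangent_bundle L (Dom L f)"
  "btgt (tangent_mor L f) = tangent_bundle L (Cod L f)"
  "bbase (tangent_mor L f) = f" "btop (tangent_mor L f) = TAr L f"
  by (simp_all add: tangent_mor_def)

lemma tangent_mor_DBun:
  assumes "f \<in> Ar L"
  shows "tangent_mor L f \<in> Ar (DBun L)"
proof -
  have "TAr L f ;; tp L (Cod L f) = tp L (Dom L f) ;; f"
    using tp_natural assms by (auto simp: nat_trans_def)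
  moreover have "TAr L f ;; tlift L (Cod L f) = tlift L (Dom L f) ;; TAr L (TAr L f)"
    using tlift_natural assms by (auto simp: nat_trans_def)
  ultimately show ?thesis
    using assms display_tangent by (simp add: linear_morphism_def hom_def)
qed

lemma tangent_mor_Id: "A \<in> Ob L \<Longrightarrow> tangent_mor L (Id L A) = Id (DBun L) (tangent_bundle L A)"
  using is_functorD(3)[OF T_functor, of A] by (simp add: tangent_mor_def)

lemma tangent_mor_Comp:
  "\<lbrakk>f \<in> Ar L; g \<in> Ar L; Cod L f = Dom L g\<rbrakk>
    \<Longrightarrow> tangent_mor L (f ;; g) = tangent_mor L f ;;\<^bsub>DBun L\<^esub> tangent_mor L g"
  using is_functorD(4)[OF T_functor, of f g] by (simp add: tangent_mor_def)

lemma cotangent_bundle_prj: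
  assumes "A \<in> Ob L"
  shows "bprj (cotangent_bundle L A) \<in> Ar L" "Cod L (bprj (cotangent_bundle L A)) = A"
proof -
  have "cotangent_bundle L A \<in> display L"
    using is_functorD(1)[OF bdual_functor] display_tangent[OF assms]
    by (simp add: cotangent_bundle_def)
  then show "bprj (cotangent_bundle L A) \<in> Ar L"
    using display_differential by (auto simp: differential_bundle_def)
  show "Cod L (bprj (cotangent_bundle L A)) = A"
    using bdual_ob_base[OF display_tangent[OF assms]] assms by (simp add: cotangent_bundle_def)
qed

lemma cotangent_map_lens:
  assumes f: "f \<in> Ar L"
  defines "p \<equiv> bprj (cotangent_bundle L (Dom L f))"
    and "q \<equiv> bprj (cotangent_bundle L (Cod L f))"
  shows "cotangent_map L f \<in> Ar L" "Dom L (cotangent_map L f) = Dom L (pb1 L f q)"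
    "Cod L (cotangent_map L f) = Dom L p" "cotangent_map L f ;; p = pb1 L f q"
proof -
  have "is_pullback L f q (pb1 L f q) (pb2 L f q)"
    using cotangent_bundle_prj f by (intro pullbacks) (auto simp: q_def)
  note D = is_pullbackD[OF this]
  let ?d = "bdual_ar L (tangent_mor L f)"
  have d: "?d \<in> Ar (DBun_dual L)" "bsrc ?d = cotangent_bundle L (Dom L f)"
    "btgt ?d = cotangent_bundle L (Cod L f)"
    using is_functorD(2)[OF bdual_functor tangent_mor_DBun[OF f]]
    by (simp_all add: cotangent_bundle_def hom_def)
  have "bbase ?d = f"
    using bdual_ar_base[OF tangent_mor_DBun[OF f]] by simp
  moreover have "linear_morphism L (reindex L (bbase ?d) (btgt ?d)) (bsrc ?d)
      (Id L (base L (bsrc ?d))) (btop ?d)"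
    using d(1) by (simp add: DBun_dual_def)
  ultimately have "linear_morphism L (reindex L f (cotangent_bundle L (Cod L f)))
      (cotangent_bundle L (Dom L f)) (Id L (base L (cotangent_bundle L (Dom L f))))
      (cotangent_map L f)"
    unfolding d(2,3) cotangent_map_def by simp
  moreover have "bprj (reindex L f (cotangent_bundle L (Cod L f))) = pb1 L f q"
    by (simp add: reindex_def induced_bundle_def q_def)
  moreover have "base L (cotangent_bundle L (Dom L f)) = Dom L f"
    using cotangent_bundle_prj(2) f by simp
  ultimately have lin: "cotangent_map L f \<in> hom L (Dom L (pb1 L f q)) (Dom L p)"
    "cotangent_map L f ;; p = pb1 L f q ;; Id L (Dom L f)"
    by (simp_all add: linear_morphism_def p_def)
  then show "cotangent_map L f \<in> Ar L" "Dom L (cotangent_map L f) = Dom L (pb1 L f q)"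
    "Cod L (cotangent_map L f) = Dom L p"
    by (simp_all add: hom_def)
  show "cotangent_map L f ;; p = pb1 L f q"
    using lin(2) D(3,6) by simp
qed

lemma cotangent_map_Id:
  assumes A: "A \<in> Ob L"
  shows "cotangent_map L (Id L A) = pb2 L (Id L A) (bprj (cotangent_bundle L A))"
proof -
  have "bdual_ar L (tangent_mor L (Id L A)) = Id (DBun_dual L) (cotangent_bundle L A)"
    using is_functorD(3)[OF bdual_functor, of "tangent_bundle L A"] display_tangent[OF A]
    unfolding tangent_mor_Id[OF A] cotangent_bundle_def DBun_simps(1) by blast
  then show ?thesis
    using cotangent_bundle_prj[OF A] by (simp add: cotangent_map_def DBun_dual_def)
qed

lemma cotangent_map_Comp:
  assumes f: "f \<in> Ar L" "g \<in> Ar L" "Cod L f = Dom L g"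
  defines "q \<equiv> bprj (cotangent_bundle L (Cod L f))" and "r \<equiv> bprj (cotangent_bundle L (Cod L g))"
  shows "cotangent_map L (f ;; g) =
    reindex_comp L f g r ;; reindex_ar L f (pb1 L g r) q (cotangent_map L g) ;; cotangent_map L f"
proof -
  note F = tangent_mor_DBun[OF f(1)] and G = tangent_mor_DBun[OF f(2)]
  have "bdual_ar L (tangent_mor L (f ;; g)) =
      bdual_ar L (tangent_mor L f) ;;\<^bsub>DBun_dual L\<^esub> bdual_ar L (tangent_mor L g)"
    unfolding tangent_mor_Comp[OF f]
    by (rule is_functorD(4)[OF bdual_functor F G]) (simp add: f(3))
  moreover have "btgt (bdual_ar L (tangent_mor L h)) = cotangent_bundle L (Cod L h)"
    if "h \<in> Ar L" for h
    using is_functorD(2)[OF bdual_functor tangent_mor_DBun[OF that]]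
    by (simp add: cotangent_bundle_def hom_def)
  ultimately show ?thesis
    using f bdual_ar_base[OF F] bdual_ar_base[OF G]
    by (simp add: cotangent_map_def DBun_dual_def q_def r_def)
qed

lemma cotangent_lens_functor:
  "is_functor L (Lens L) (\<lambda>A. bprj (cotangent_bundle L A))
    (\<lambda>f. \<lparr>lsrc = bprj (cotangent_bundle L (Dom L f)), ltgt = bprj (cotangent_bundle L (Cod L f)),
      lbase = f,
      lspan = span_class L (cotangent_map L f) (pb2 L f (bprj (cotangent_bundle L (Cod L f))))\<rparr>)"
  (is "is_functor L (Lens L) ?Fo ?Fa")
  unfolding is_functor_def
proof (intro conjI ballI impI)
  fix A assume A: "A \<in> Ob L"
  then show "?Fo A \<in> Ob (Lens L)" by (simp add: cotangent_bundle_prj)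
  let ?q = "bprj (cotangent_bundle L A)"
  let ?b = "pb2 L (Id L A) ?q"
  have P: "is_pullback L (Id L (Cod L ?q)) ?q (pb1 L (Id L A) ?q) ?b"
    using A cotangent_bundle_prj[OF A] by (simp add: pullbacks)
  note D = is_pullbackD[OF P]
  \<comment> \<open>Both legs of the span of the identity are the comparison \<open>1\<^sup>*q \<simeq> q\<close>, so it represents the
    same class as the identity span.\<close>
  have "span_class L (?b ;; Id L (Dom L ?q)) (?b ;; Id L (Dom L ?q)) =
      span_class L (Id L (Dom L ?q)) (Id L (Dom L ?q))"
    by (rule span_class_iso_apex) (use is_pullback_Id_iso[OF P] D in auto)
  then show "?Fa (Id L A) = Id (Lens L) (?Fo A)"
    using A D cotangent_map_Id[OF A] cotangent_bundle_prj[OF A] by simp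
next
  fix f assume f: "f \<in> Ar L"
  let ?q = "bprj (cotangent_bundle L (Cod L f))"
  have "is_pullback L f ?q (cotangent_map L f ;; bprj (cotangent_bundle L (Dom L f))) (pb2 L f ?q)"
    using f by (simp add: cotangent_map_lens cotangent_bundle_prj pullbacks)
  then show "?Fa f \<in> hom (Lens L) (?Fo (Dom L f)) (?Fo (Cod L f))"
    using f lens_arrowsI by (simp add: hom_def cotangent_map_lens cotangent_bundle_prj)
next
  fix f g assume f: "f \<in> Ar L" and g: "g \<in> Ar L" and fg: "Cod L f = Dom L g"
  show "?Fa (f ;; g) = ?Fa f ;;\<^bsub>Lens L\<^esub> ?Fa g"
    using f g fg cotangent_map_lens[OF f] cotangent_map_lens[OF g]
    by (simp add: cotangent_map_Comp span_comp_reindex cotangent_bundle_prj)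
qed

end

theorem proposition3p8:
  fixes L :: "('o, 'm, 'z) rtcat_scheme"
  assumes "reverse_tangent_category L"
  shows "category (Lens L) \<and>
    (\<exists>Fo Fa. is_functor L (Lens L) Fo Fa \<and>
      (\<forall>A \<in> Ob L. Fo A = bprj (cotangent_bundle L A)) \<and>
      (\<forall>A \<in> Ob L. \<forall>B \<in> Ob L. \<forall>f \<in> hom L A B.
        Fa f = \<lparr>lsrc = bprj (cotangent_bundle L A),
          ltgt = bprj (cotangent_bundle L B),
          lbase = f,
          lspan = span_class L (cotangent_map L f) (pb2 L f (bprj (cotangent_bundle L B)))\<rparr>))"
proof -
  interpret reverse_tangent_category L by (fact assms)
  show ?thesis
    using category_Lens cotangent_lens_functor by (fastforce simp: hom_def)
qed

end
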